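(* Let $(p_k)_{k\ge 0}$ be a probability distribution on $\mathbb N=\{0,1,2,\dots\}$ with $p_0>0$, $p_0+p_1<1$ and $R(v):=\sum_{k\ge2}p_kv^k<\infty$ for all $v$. Suppose the underlying free Bienaymé–Galton–Watson process with offspring law $(p_k)$ is subcritical or critical. Let $b_c$ be the critical value defined in the context. Then the eventual extinction probability of the Gibbs tilted process, $$\rho=\lim_{n\to\infty}\mathbb P_n^x(N_n=0),$$ exists, with $$\rho=\begin{cases}1&\text{if } b\le b_c,\\ 0&\text{if } b>b_c>1.\end{cases}$$
   Context: Free process: it is subcritical if $\sum_{k\ge0}k\,p_k<1$ and critical if $\sum_{k\ge0}k\,p_k=1$. Trees. $\mathcal T_n$ is the set of planar rooted trees in which the root has distance $0$, and the nodes $i\in\omega$ are those at distance $|i|\le n$ from the root; each node $i\in\omega$ has a number of offspring $X_i=X_i(\omega)\in\mathbb N$. The offspring of nodes at distance exactly $n$ (located at distance $n+1$) are called external nodes; they carry no information other than their number and are not counted among the nodes $i\in\omega$. $N_n(\omega)=\sum_{i\in\omega,\,|i|=n}X_i(\omega)$ is the number of external nodes. The root is denoted $0$, and $a(i)$ is the parent of node $i$. For the root, $X_{a(0)}:=x\in\{1,2,\dots\}$ is a prescribed boundary condition. Free measure: $\mathbb P^{GW}(\omega)=\prod_{i\in\omega}p_{X_i(\omega)}$ for $\omega\in\mathcal T_n$. Interaction: $\varphi(X,Y)=-1_{X\ge2}1_{Y\ge2}$ and $H_n^x(\omega)=\sum_{i\in\omega}\varphi(X_{a(i)},X_i)$ (the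 root contributes $\varphi(x,X_0)$). Interacting (Gibbs tilted) measure: with $\beta\ge0$ and $b=e^\beta\ge1$, $\Xi_n^x=\sum_{\omega\in\mathcal T_n}\mathbb P^{GW}(\omega)e^{-\beta H_n^x(\omega)}$ and $\mathbb P_n^x(\omega)=(\Xi_n^x)^{-1}\mathbb P^{GW}(\omega)e^{-\beta H_n^x(\omega)}$. Critical value: $(b_c,v_c)$ is the solution $(b,v)$ with $v\ge1$ of the system $$v=\frac{p_0}{1-p_1}+\frac{(1-p_1)b+p_1}{1-p_1}R(v),\qquad 1=\frac{(1-p_1)b+p_1}{1-p_1}R'(v).$$ *)

theory Defs
  imports "HOL-Analysis.Analysis" "HOL-Probability.Probability_Mass_Function"
begin

(* Planar rooted trees in Ulam-Harris notation: a node is the list of the birth ranks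
   (starting at 0) of its ancestors and itself, so [] is the root, length i = |i|, and
   butlast i is the parent of i. *)

definition planar_tree :: "nat list set \<Rightarrow> bool" where
  "planar_tree \<omega> \<longleftrightarrow> finite \<omega> \<and> [] \<in> \<omega> \<and>
     (\<forall>i k. i @ [k] \<in> \<omega> \<longrightarrow> i \<in> \<omega> \<and> (\<forall>j<k. i @ [j] \<in> \<omega>))"

(* The external nodes, at distance n + 1, are kept as elements of the set, in order to encode
   the offspring numbers at distance n; inner_nodes n removes them again. *)

definition trees :: "nat \<Rightarrow> nat list set set" where
  "trees n = {\<omega>. planar_tree \<omega> \<and> (\<forall>i\<in>\<omega>. length i \<le> n + 1)}"

definition inner_nodes :: "nat \<Rightarrow> nat list set \<Rightarrow> nat list set" where
  "inner_nodes n \<omega> = {i \<in> \<omega>. length i \<le> n}"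

definition offspring :: "nat list set \<Rightarrow> nat list \<Rightarrow> nat" where
  "offspring \<omega> i = card {k. i @ [k] \<in> \<omega>}"

definition parent_offspring :: "nat \<Rightarrow> nat list set \<Rightarrow> nat list \<Rightarrow> nat" where
  "parent_offspring x \<omega> i = (if i = [] then x else offspring \<omega> (butlast i))"

definition num_external :: "nat \<Rightarrow> nat list set \<Rightarrow> nat" where
  "num_external n \<omega> = (\<Sum>i \<in> {i \<in> \<omega>. length i = n}. offspring \<omega> i)"

definition free_weight :: "nat pmf \<Rightarrow> nat \<Rightarrow> nat list set \<Rightarrow> real" where
  "free_weight p n \<omega> = (\<Prod>i \<in> inner_nodes n \<omega>. pmf p (offspring \<omega> i))"

definition interaction :: "nat \<Rightarrow> nat \<Rightarrow> real" where
  "interaction X Y = - (of_bool (X \<ge> 2) * of_bool (Y \<ge> 2))"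

definition energy :: "nat \<Rightarrow> nat \<Rightarrow> nat list set \<Rightarrow> real" where
  "energy x n \<omega> =
     (\<Sum>i \<in> inner_nodes n \<omega>. interaction (parent_offspring x \<omega> i) (offspring \<omega> i))"

definition gibbs_weight :: "nat pmf \<Rightarrow> real \<Rightarrow> nat \<Rightarrow> nat \<Rightarrow> nat list set \<Rightarrow> real" where
  "gibbs_weight p \<beta> x n \<omega> = free_weight p n \<omega> * exp (- \<beta> * energy x n \<omega>)"

definition partition_function :: "nat pmf \<Rightarrow> real \<Rightarrow> nat \<Rightarrow> nat \<Rightarrow> real" where
  "partition_function p \<beta> x n = (\<Sum>\<^sub>\<infinity>\<omega> \<in> trees n. gibbs_weight p \<beta> x n \<omega>)"

definition gibbs_measure :: "nat pmf \<Rightarrow> real \<Rightarrow> nat \<Rightarrow> nat \<Rightarrow> nat list set \<Rightarrow> real" where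
  "gibbs_measure p \<beta> x n \<omega> = inverse (partition_function p \<beta> x n) * gibbs_weight p \<beta> x n \<omega>"

definition gibbs_prob ::
    "nat pmf \<Rightarrow> real \<Rightarrow> nat \<Rightarrow> nat \<Rightarrow> (nat list set \<Rightarrow> bool) \<Rightarrow> real" where
  "gibbs_prob p \<beta> x n A = (\<Sum>\<^sub>\<infinity>\<omega> \<in> {\<omega> \<in> trees n. A \<omega>}. gibbs_measure p \<beta> x n \<omega>)"

definition subcritical :: "nat pmf \<Rightarrow> bool" where
  "subcritical p \<longleftrightarrow>
     summable (\<lambda>k. real k * pmf p k) \<and> (\<Sum>k. real k * pmf p k) < 1"

definition critical :: "nat pmf \<Rightarrow> bool" where
  "critical p \<longleftrightarrow> (\<lambda>k. real k * pmf p k) sums 1"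

definition R :: "nat pmf \<Rightarrow> real \<Rightarrow> real" where
  "R p v = (\<Sum>k. pmf p (k + 2) * v ^ (k + 2))"

definition critical_system :: "nat pmf \<Rightarrow> real \<Rightarrow> real \<Rightarrow> bool" where
  "critical_system p b v \<longleftrightarrow>
     v = pmf p 0 / (1 - pmf p 1) + ((1 - pmf p 1) * b + pmf p 1) / (1 - pmf p 1) * R p v \<and>
     1 = ((1 - pmf p 1) * b + pmf p 1) / (1 - pmf p 1) * deriv (R p) v"

(* For a subcritical or critical p with p_0 > 0, p_0 + p_1 < 1 and R finite everywhere, the
   solution with v >= 1 exists and is unique: eliminating b leaves
   (v - p_0 / (1 - p_1)) * R'(v) = R(v), and the difference of the two sides is strictly
   increasing on [1, \<infinity>), nonpositive at 1 and unbounded above. *)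

definition critical_point :: "nat pmf \<Rightarrow> real \<times> real" where
  "critical_point p = (THE (b, v). v \<ge> 1 \<and> critical_system p b v)"

definition b_crit :: "nat pmf \<Rightarrow> real" where
  "b_crit p = fst (critical_point p)"

end

theory Submission
  imports Defs
begin

text \<open>
  Splitting a tree at its root shows that the partition functions for \<open>x = 1\<close> and for \<open>x \<ge> 2\<close>,
  with an extra weight \<open>s\<close> on every external node, are the iterates of
  \<open>(u, w) \<mapsto> (p\<^sub>0 + p\<^sub>1 u + R(w), p\<^sub>0 + p\<^sub>1 u + b R(w))\<close> started at \<open>(s, s)\<close>. The extinction
  probability is the ratio of the iterates for \<open>s = 0\<close> and \<open>s = 1\<close>. Eliminating \<open>u\<close> from the
  fixed point equation leaves the first equation of the critical system; the second one is
  tangency.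

  If \<open>b \<le> b\<^sub>c\<close>, the iterates from \<open>(0, 0)\<close> increase to a fixed point, which lies above \<open>(1, 1)\<close>
  because the free process is not supercritical. It therefore also bounds the iterates from
  \<open>(1, 1)\<close>, and both sequences have the same limit. If \<open>b > b\<^sub>c\<close>, there is no fixed point, so the
  iterates from \<open>(0, 0)\<close> diverge. The first of them is below \<open>(1, 1)\<close>, so the iterates from
  \<open>(1, 1)\<close> are always at least one step ahead; as one step grows at least quadratically, the
  ratio tends to 0.
\<close>

subsection \<open>Splitting trees at the root\<close>

definition trees_upto :: "nat \<Rightarrow> nat list set set" where
  "trees_upto m = {\<omega>. planar_tree \<omega> \<and> (\<forall>i\<in>\<omega>. length i \<le> m)}"

text \<open>The Boltzmann factor \<open>exp (- \<beta> * interaction x k)\<close> of one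
  parent-child pair, with \<open>b\<close> in place of \<open>exp \<beta>\<close>.\<close>

definition coupling :: "real \<Rightarrow> nat \<Rightarrow> nat \<Rightarrow> real" where
  "coupling b x k = (if x \<ge> 2 \<and> k \<ge> 2 then b else 1)"

text \<open>
  The nodes at depth \<open>m\<close> are the external ones: \<open>m\<close> is \<open>n + 1\<close> in terms of \<^const>\<open>trees\<close>, and
  \<open>m = 0\<close> is the case of a root that is itself external, from which the recursion starts.
\<close>

definition node_weight ::
    "nat pmf \<Rightarrow> real \<Rightarrow> real \<Rightarrow> nat \<Rightarrow> nat \<Rightarrow> nat list set \<Rightarrow> nat list \<Rightarrow> real" where
  "node_weight p b s m x \<omega> i =
     (if length i < m
      then pmf p (offspring \<omega> i) * coupling b (parent_offspring x \<omega> i) (offspring \<omega> i)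
      else s)"

definition tree_weight ::
    "nat pmf \<Rightarrow> real \<Rightarrow> real \<Rightarrow> nat \<Rightarrow> nat \<Rightarrow> nat list set \<Rightarrow> real" where
  "tree_weight p b s m x \<omega> = (\<Prod>i\<in>\<omega>. node_weight p b s m x \<omega> i)"

text \<open>Subtrees hung below a new root in order of birth. A list serves because its length is
  then the offspring number of the root.\<close>

definition graft :: "nat list set list \<Rightarrow> nat list set" where
  "graft ts = insert [] (\<Union>j<length ts. (#) j ` (ts ! j))"

lemma Nil_in_graft [simp]: "[] \<in> graft ts"
  by (simp add: graft_def)

lemma Cons_in_graft [simp]: "j # i \<in> graft ts \<longleftrightarrow> j < length ts \<and> i \<in> ts ! j"
  by (auto simp: graft_def)

lemma planar_tree_finite: "planar_tree \<omega> \<Longrightarrow> finite \<omega>"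
  and planar_tree_Nil: "planar_tree \<omega> \<Longrightarrow> [] \<in> \<omega>"
  and planar_tree_parent: "planar_tree \<omega> \<Longrightarrow> i @ [k] \<in> \<omega> \<Longrightarrow> i \<in> \<omega>"
  and planar_tree_sibling: "planar_tree \<omega> \<Longrightarrow> i @ [k] \<in> \<omega> \<Longrightarrow> j < k \<Longrightarrow> i @ [j] \<in> \<omega>"
  unfolding planar_tree_def by blast+

lemma planar_treeI:
  assumes "finite \<omega>" "[] \<in> \<omega>"
    and "\<And>i k. i @ [k] \<in> \<omega> \<Longrightarrow> i \<in> \<omega> \<and> (\<forall>j<k. i @ [j] \<in> \<omega>)"
  shows "planar_tree \<omega>"
  unfolding planar_tree_def using assms by blast

lemma finite_downward_closed_eq_lessThan:
  fixes S :: "nat set"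
  assumes "finite S" and down: "\<And>k j. k \<in> S \<Longrightarrow> j < k \<Longrightarrow> j \<in> S"
  shows "S = {..<card S}"
proof -
  define n where "n = (LEAST n. n \<notin> S)"
  have n: "n \<notin> S"
    unfolding n_def using ex_new_if_finite[OF infinite_UNIV_nat \<open>finite S\<close>] by (metis LeastI)
  have "k \<in> S" if "k < n" for k
    using that not_less_Least unfolding n_def by blast
  moreover have "k < n" if "k \<in> S" for k
    using that n down by (metis linorder_neqE_nat)
  ultimately have "S = {..<n}" by auto
  then show ?thesis by simp
qed

text \<open>The birth ranks of the children of a node form a finite initial segment of the naturals,
  so their number alone determines them.\<close>

lemma child_iff_less_offspring:
  assumes "planar_tree \<omega>"
  shows "i @ [k] \<in> \<omega> \<longleftrightarrow> k < offspring \<omega> i"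
proof -
  let ?S = "{k. i @ [k] \<in> \<omega>}"
  have "finite ((\<lambda>k. i @ [k]) -` \<omega>)"
    using assms by (intro finite_vimageI) (auto simp: planar_tree_finite inj_def)
  then have "finite ?S" by (simp add: vimage_def)
  moreover have "j \<in> ?S" if "k \<in> ?S" "j < k" for k j
    using that planar_tree_sibling[OF assms] by simp
  ultimately have "?S = {..<offspring \<omega> i}"
    unfolding offspring_def by (rule finite_downward_closed_eq_lessThan)
  then show ?thesis by auto
qed

lemma planar_tree_prefix:
  assumes "planar_tree \<omega>" "i @ l \<in> \<omega>"
  shows "i \<in> \<omega>"
  using assms(2)
proof (induction l rule: rev_induct)
  case (snoc k l)
  then show ?case using planar_tree_parent[OF assms(1), of "i @ l" k] by simp
qed simp

lemma planar_tree_graft: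
  assumes "\<And>t. t \<in> set ts \<Longrightarrow> planar_tree t"
  shows "planar_tree (graft ts)"
proof -
  have nth: "planar_tree (ts ! j)" if "j < length ts" for j
    using assms that by simp
  have "finite (graft ts)"
    unfolding graft_def using nth by (auto simp: planar_tree_finite)
  moreover have "i \<in> graft ts \<and> (\<forall>j<k. i @ [j] \<in> graft ts)" if "i @ [k] \<in> graft ts" for i k
  proof (cases i)
    case Nil
    with that nth show ?thesis by (auto simp: planar_tree_Nil)
  next
    case (Cons l i')
    with that nth show ?thesis by (auto intro: planar_tree_parent planar_tree_sibling)
  qed
  ultimately show ?thesis by (rule planar_treeI[OF _ Nil_in_graft])
qed

lemma planar_tree_subtree:
  assumes "planar_tree \<omega>" "[j] \<in> \<omega>"
  shows "planar_tree {i. j # i \<in> \<omega>}"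
proof -
  have "finite ((#) j -` \<omega>)"
    using assms by (intro finite_vimageI) (auto simp: planar_tree_finite)
  show ?thesis
  proof (rule planar_treeI)
    show "finite {i. j # i \<in> \<omega>}" "[] \<in> {i. j # i \<in> \<omega>}"
      using \<open>finite ((#) j -` \<omega>)\<close> assms(2) by (simp_all add: vimage_def)
  next
    fix i k assume "i @ [k] \<in> {i. j # i \<in> \<omega>}"
    then have "(j # i) @ [k] \<in> \<omega>" by simp
    then have "j # i \<in> \<omega>" "\<And>l. l < k \<Longrightarrow> (j # i) @ [l] \<in> \<omega>"
      using planar_tree_parent[OF assms(1)] planar_tree_sibling[OF assms(1)] by blast+
    then show "i \<in> {i. j # i \<in> \<omega>} \<and> (\<forall>l<k. i @ [l] \<in> {i. j # i \<in> \<omega>})"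
      by simp
  qed
qed

lemma offspring_graft_Nil: "(\<And>t. t \<in> set ts \<Longrightarrow> [] \<in> t) \<Longrightarrow> offspring (graft ts) [] = length ts"
proof -
  assume "\<And>t. t \<in> set ts \<Longrightarrow> [] \<in> t"
  then have "{k. [] @ [k] \<in> graft ts} = {..<length ts}" by auto
  then show ?thesis by (simp add: offspring_def)
qed

lemma offspring_graft_Cons:
  "j < length ts \<Longrightarrow> offspring (graft ts) (j # i) = offspring (ts ! j) i"
  by (simp add: offspring_def)

text \<open>The inverse cuts off the root and lists the subtrees below \<open>[0]\<close>,
  \<open>[1]\<close> and so on. Lists of every length occur; the empty one gives the bare
  root.\<close>

lemma bij_betw_graft:
  "bij_betw graft {ts. set ts \<subseteq> trees_upto m} (trees_upto (Suc m))"
proof (rule bij_betw_byWitness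
    [where f' = "\<lambda>\<omega>. map (\<lambda>j. {i. j # i \<in> \<omega>}) [0..<offspring \<omega> []]"])
  have "map (\<lambda>j. {i. j # i \<in> graft ts}) [0..<offspring (graft ts) []] = ts"
    if "set ts \<subseteq> trees_upto m" for ts
  proof -
    have "offspring (graft ts) [] = length ts"
      using that by (intro offspring_graft_Nil) (auto simp: trees_upto_def planar_tree_Nil)
    then show ?thesis by (auto intro!: nth_equalityI)
  qed
  then show "\<forall>ts\<in>{ts. set ts \<subseteq> trees_upto m}.
      map (\<lambda>j. {i. j # i \<in> graft ts}) [0..<offspring (graft ts) []] = ts"
    by simp
next
  have "graft (map (\<lambda>j. {i. j # i \<in> \<omega>}) [0..<offspring \<omega> []]) = \<omega>" (is "graft ?ts = \<omega>")
    if "planar_tree \<omega>" for \<omega>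
  proof (rule set_eqI)
    fix i
    show "i \<in> graft ?ts \<longleftrightarrow> i \<in> \<omega>"
    proof (cases i)
      case Nil
      then show ?thesis using that by (simp add: planar_tree_Nil)
    next
      case (Cons j i')
      have "j < offspring \<omega> []" if "j # i' \<in> \<omega>"
        using planar_tree_prefix[OF \<open>planar_tree \<omega>\<close>, of "[j]" i']
          child_iff_less_offspring[OF \<open>planar_tree \<omega>\<close>, of "[]" j] that by simp
      then show ?thesis using Cons by auto
    qed
  qed
  then show "\<forall>\<omega>\<in>trees_upto (Suc m).
      graft (map (\<lambda>j. {i. j # i \<in> \<omega>}) [0..<offspring \<omega> []]) = \<omega>"
    by (simp add: trees_upto_def)
next
  have "graft ts \<in> trees_upto (Suc m)" if "set ts \<subseteq> trees_upto m" for ts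
  proof -
    have "planar_tree (graft ts)"
      using that by (intro planar_tree_graft) (auto simp: trees_upto_def)
    moreover have "length i \<le> Suc m" if "i \<in> graft ts" for i
      using that \<open>set ts \<subseteq> trees_upto m\<close> by (cases i) (auto simp: trees_upto_def dest!: nth_mem)
    ultimately show ?thesis by (simp add: trees_upto_def)
  qed
  then show "graft ` {ts. set ts \<subseteq> trees_upto m} \<subseteq> trees_upto (Suc m)" by auto
next
  have "{i. j # i \<in> \<omega>} \<in> trees_upto m" if "\<omega> \<in> trees_upto (Suc m)" "j < offspring \<omega> []" for \<omega> j
    using that planar_tree_subtree[of \<omega> j] child_iff_less_offspring[of \<omega> "[]" j]
    by (auto simp: trees_upto_def)
  then show "(\<lambda>\<omega>. map (\<lambda>j. {i. j # i \<in> \<omega>}) [0..<offspring \<omega> []]) ` trees_upto (Suc m)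
      \<subseteq> {ts. set ts \<subseteq> trees_upto m}"
    by auto
qed

text \<open>Seen from a subtree, the parent of its root has \<open>length ts\<close> children, so
  this number takes over the role of the boundary condition \<open>x\<close>.\<close>

lemma node_weight_graft_Cons:
  assumes "\<And>t. t \<in> set ts \<Longrightarrow> [] \<in> t" "j < length ts"
  shows "node_weight p b s (Suc m) x (graft ts) (j # i) =
    node_weight p b s m (length ts) (ts ! j) i"
proof -
  have "parent_offspring x (graft ts) (j # i) = parent_offspring (length ts) (ts ! j) i"
    using assms by (auto simp: parent_offspring_def offspring_graft_Nil offspring_graft_Cons)
  then show ?thesis
    using assms by (simp add: node_weight_def offspring_graft_Cons)
qed

text \<open>The subtrees influence each other only through the offspring number of the root. Once it
  is fixed, the weight factorises.\<close>

lemma tree_weight_graft: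
  assumes "set ts \<subseteq> trees_upto m"
  shows "tree_weight p b s (Suc m) x (graft ts) =
    pmf p (length ts) * coupling b x (length ts)
      * prod_list (map (tree_weight p b s m (length ts)) ts)"
proof -
  let ?n = "node_weight p b s (Suc m) x (graft ts)"
  have Nil: "[] \<in> t" if "t \<in> set ts" for t
    using assms that by (auto simp: trees_upto_def planar_tree_Nil)
  have fin: "finite (ts ! j)" if "j < length ts" for j
    using assms nth_mem[OF that] by (auto simp: trees_upto_def planar_tree_finite)
  have "tree_weight p b s (Suc m) x (graft ts) =
      ?n [] * (\<Prod>i\<in>(\<Union>j<length ts. (#) j ` (ts ! j)). ?n i)"
    unfolding tree_weight_def graft_def using fin by (subst prod.insert) auto
  also have "(\<Prod>i\<in>(\<Union>j<length ts. (#) j ` (ts ! j)). ?n i) =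
      (\<Prod>j<length ts. \<Prod>i\<in>(#) j ` (ts ! j). ?n i)"
    using fin by (intro prod.UNION_disjoint) auto
  also have "\<dots> = (\<Prod>j<length ts. tree_weight p b s m (length ts) (ts ! j))"
    using Nil by (intro prod.cong refl)
      (simp add: tree_weight_def prod.reindex node_weight_graft_Cons)
  also have "\<dots> = prod_list (map (tree_weight p b s m (length ts)) ts)"
    by (simp add: prod.list_conv_set_nth atLeast0LessThan)
  also have "?n [] = pmf p (length ts) * coupling b x (length ts)"
    using Nil by (simp add: node_weight_def parent_offspring_def offspring_graft_Nil)
  finally show ?thesis .
qed

section \<open>Sums of weights over all trees of bounded height\<close>

lemma tree_weight_nonneg: "0 \<le> b \<Longrightarrow> 0 \<le> s \<Longrightarrow> 0 \<le> tree_weight p b s m x \<omega>"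
  by (auto simp: tree_weight_def node_weight_def coupling_def intro!: prod_nonneg)

lemma prod_list_nonneg_map:
  fixes f :: "'a \<Rightarrow> real"
  shows "(\<And>a. a \<in> set as \<Longrightarrow> 0 \<le> f a) \<Longrightarrow> 0 \<le> prod_list (map f as)"
  by (induction as) auto

text \<open>Distributivity for infinite sums, by splitting off the head of the list. Nonnegativity
  turns the iterated sum into a sum over pairs.\<close>

lemma has_sum_prod_list:
  fixes f :: "'a \<Rightarrow> real"
  assumes f: "(f has_sum S) A" and nonneg: "\<And>a. a \<in> A \<Longrightarrow> 0 \<le> f a"
  shows "((\<lambda>as. prod_list (map f as)) has_sum S ^ k) {as. set as \<subseteq> A \<and> length as = k}"
proof (induction k)
  case 0
  have "{as. set as \<subseteq> A \<and> length as = 0} = {[]}" by auto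
  then show ?case using has_sum_finite[of "{[]}" "\<lambda>as. prod_list (map f as)"] by simp
next
  case (Suc k)
  let ?L = "\<lambda>k. {as. set as \<subseteq> A \<and> length as = k}"
  let ?g = "\<lambda>(a, as). f a * prod_list (map f as)"
  have inner: "((\<lambda>as. ?g (a, as)) has_sum f a * S ^ k) (?L k)" for a
    using has_sum_cmult_right[OF Suc.IH, of "f a"] by simp
  have outer: "((\<lambda>a. f a * S ^ k) has_sum S * S ^ k) A"
    using f by (rule has_sum_cmult_left)
  have "?g summable_on (A \<times> ?L k)"
    using outer
    by (intro summable_on_SigmaI[OF inner])
      (auto simp: summable_on_def intro!: mult_nonneg_nonneg nonneg prod_list_nonneg_map)
  then have "(?g has_sum S * S ^ k) (A \<times> ?L k)"
    by (rule has_sum_SigmaI[OF inner outer])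
  moreover have "bij_betw (\<lambda>(a, as). a # as) (A \<times> ?L k) (?L (Suc k))"
    by (rule bij_betw_byWitness[where f' = "\<lambda>as. (hd as, tl as)"]) (auto simp: length_Suc_conv)
  ultimately show ?case
    by (subst has_sum_reindex_bij_betw[symmetric]) (auto simp: case_prod_unfold)
qed

text \<open>The generating function, in \<open>s\<close>, of the number of external nodes under the
  unnormalised Gibbs weight. Of \<open>x\<close> it matters only whether it is at least 2, so the
  values at \<open>1\<close> and \<open>2\<close> carry the whole recursion.\<close>

primrec weight_gf :: "nat pmf \<Rightarrow> real \<Rightarrow> real \<Rightarrow> nat \<Rightarrow> nat \<Rightarrow> real" where
  "weight_gf p b s 0 x = s"
| "weight_gf p b s (Suc m) x =
     pmf p 0 + pmf p 1 * weight_gf p b s m 1 + (if x \<ge> 2 then b else 1) * R p (weight_gf p b s m 2)"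

lemma weight_gf_eq: "2 \<le> x \<Longrightarrow> weight_gf p b s m x = weight_gf p b s m 2"
  by (cases m) auto

lemma R_nonneg:
  assumes "\<And>v :: real. summable (\<lambda>k. pmf p (k + 2) * v ^ (k + 2))" "0 \<le> v"
  shows "0 \<le> R p v"
  unfolding R_def using assms by (intro suminf_nonneg) auto

lemma weight_gf_nonneg:
  assumes "\<And>v :: real. summable (\<lambda>k. pmf p (k + 2) * v ^ (k + 2))" "0 \<le> b" "0 \<le> s"
  shows "0 \<le> weight_gf p b s m x"
  using assms by (induction m arbitrary: x) (auto intro!: add_nonneg_nonneg mult_nonneg_nonneg R_nonneg)

text \<open>A root with \<open>k\<close> children contributes \<open>k\<close> equal factors with
  boundary condition \<open>k\<close>. The terms \<open>k = 0\<close> (an empty power, hence 1) and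
  \<open>k = 1\<close> are split off; from \<open>k = 2\<close> on the base no longer depends on
  \<open>k\<close>, and the rest is the series \<open>R\<close>.\<close>

lemma weight_gf_Suc_has_sum:
  assumes "\<And>v :: real. summable (\<lambda>k. pmf p (k + 2) * v ^ (k + 2))" "0 \<le> b" "0 \<le> s"
  shows "((\<lambda>k. pmf p k * coupling b x k * weight_gf p b s m k ^ k) has_sum weight_gf p b s (Suc m) x) UNIV"
proof (rule sums_nonneg_imp_has_sum)
  let ?f = "\<lambda>k. pmf p k * coupling b x k * weight_gf p b s m k ^ k"
  let ?c = "if x \<ge> 2 then b else 1"
  have "(\<lambda>k. ?c * (pmf p (k + 2) * weight_gf p b s m 2 ^ (k + 2))) sums (?c * R p (weight_gf p b s m 2))"
    unfolding R_def by (intro sums_mult summable_sums assms)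
  also have "(\<lambda>k. ?c * (pmf p (k + 2) * weight_gf p b s m 2 ^ (k + 2))) = (\<lambda>k. ?f (k + 2))"
    using weight_gf_eq[of "_ + 2" p b s m] by (auto simp: coupling_def)
  finally have "?f sums (?c * R p (weight_gf p b s m 2) + (\<Sum>k<2. ?f k))"
    by (rule iffD1[OF sums_iff_shift])
  also have "(\<Sum>k<2. ?f k) = pmf p 0 + pmf p 1 * weight_gf p b s m 1"
    by (simp add: numeral_2_eq_2 coupling_def)
  finally show "?f sums weight_gf p b s (Suc m) x" by (simp add: add_ac)
  show "0 \<le> ?f k" for k
    using assms by (auto simp: coupling_def weight_gf_nonneg)
qed

text \<open>Trees are grouped by the offspring number \<open>k\<close> of the root. The induction
  has to leave \<open>x\<close> arbitrary because the subtrees have boundary condition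
  \<open>k\<close>.\<close>

lemma tree_weight_has_sum:
  assumes "\<And>v :: real. summable (\<lambda>k. pmf p (k + 2) * v ^ (k + 2))" "0 \<le> b" "0 \<le> s"
  shows "(tree_weight p b s m x has_sum weight_gf p b s m x) (trees_upto m)"
proof (induction m arbitrary: x)
  case 0
  have "trees_upto 0 = {{[]}}"
    by (auto simp: trees_upto_def planar_tree_def)
  moreover have "tree_weight p b s 0 x {[]} = s"
    by (simp add: tree_weight_def node_weight_def)
  ultimately show ?case
    using has_sum_finite[of "{{[]}}" "tree_weight p b s 0 x"] by simp
next
  case (Suc m)
  let ?L = "\<lambda>k. {ts. set ts \<subseteq> trees_upto m \<and> length ts = k}"
  let ?g = "\<lambda>(k, ts). pmf p k * coupling b x k * prod_list (map (tree_weight p b s m k) ts)"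
  have inner: "((\<lambda>ts. ?g (k, ts)) has_sum pmf p k * coupling b x k * weight_gf p b s m k ^ k) (?L k)" for k
    using has_sum_cmult_right[OF has_sum_prod_list[OF Suc.IH tree_weight_nonneg]] assms by simp
  note outer = weight_gf_Suc_has_sum[OF assms, of x m]
  have "?g summable_on Sigma UNIV ?L"
    using outer assms
    by (intro summable_on_SigmaI[OF inner])
      (auto simp: summable_on_def coupling_def
        intro!: mult_nonneg_nonneg prod_list_nonneg_map tree_weight_nonneg)
  then have sum: "(?g has_sum weight_gf p b s (Suc m) x) (Sigma UNIV ?L)"
    by (rule has_sum_SigmaI[OF inner outer])
  have "bij_betw snd (Sigma UNIV ?L) {ts. set ts \<subseteq> trees_upto m}"
    by (rule bij_betw_byWitness[where f' = "\<lambda>ts. (length ts, ts)"]) auto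
  then have "bij_betw (graft \<circ> snd) (Sigma UNIV ?L) (trees_upto (Suc m))"
    using bij_betw_graft by (rule bij_betw_trans)
  note bij = this
  have "((\<lambda>kts. tree_weight p b s (Suc m) x ((graft \<circ> snd) kts)) has_sum weight_gf p b s (Suc m) x)
      (Sigma UNIV ?L)"
    by (subst has_sum_cong[where g = ?g]) (use sum in \<open>auto simp: tree_weight_graft\<close>)
  then show ?case
    by (simp only: has_sum_reindex_bij_betw[OF bij])
qed

section \<open>Gibbs weights and the extinction probability\<close>

lemma num_external_eq_card:
  assumes "planar_tree \<omega>"
  shows "num_external n \<omega> = card {i \<in> \<omega>. length i = Suc n}"
proof -
  \<comment> \<open>A node at depth \<open>Suc n\<close> amounts to a parent at depth
    \<open>n\<close> together with a birth rank.\<close>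
  let ?P = "SIGMA i:{i \<in> \<omega>. length i = n}. {k. i @ [k] \<in> \<omega>}"
  have fin: "finite {k. i @ [k] \<in> \<omega>}" for i
    using child_iff_less_offspring[OF assms] by simp
  have split: "butlast i \<in> \<omega> \<and> butlast i @ [last i] = i" if "i \<in> \<omega>" "length i = Suc n" for i
    using that planar_tree_prefix[OF assms, of "butlast i" "[last i]"]
    by (cases i rule: rev_cases) auto
  have "bij_betw (\<lambda>(i, k). i @ [k]) ?P {i \<in> \<omega>. length i = Suc n}"
    by (rule bij_betw_byWitness[where f' = "\<lambda>i. (butlast i, last i)"])
      (auto simp: split)
  then have "card {i \<in> \<omega>. length i = Suc n} = card ?P"
    by (simp add: bij_betw_same_card)
  also have "\<dots> = num_external n \<omega>"
    unfolding num_external_def offspring_def using assms fin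
    by (intro card_SigmaI) (simp_all add: planar_tree_finite)
  finally show ?thesis by simp
qed

lemma trees_eq: "trees n = trees_upto (Suc n)"
  by (simp add: trees_def trees_upto_def)

text \<open>The exponential turns the energy into a product of coupling factors over the inner
  nodes, and the nodes at depth \<open>Suc n\<close> contribute one factor \<open>s\<close>
  each.\<close>

lemma gibbs_weight_eq_tree_weight:
  assumes "\<omega> \<in> trees n"
  shows "gibbs_weight p \<beta> x n \<omega> * s ^ num_external n \<omega> = tree_weight p (exp \<beta>) s (Suc n) x \<omega>"
proof -
  have \<omega>: "planar_tree \<omega>" "finite \<omega>" and len: "\<And>i. i \<in> \<omega> \<Longrightarrow> length i \<le> Suc n"
    using assms by (auto simp: trees_def planar_tree_finite)
  let ?N = "node_weight p (exp \<beta>) s (Suc n) x \<omega>"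
  have "exp (- \<beta> * energy x n \<omega>) =
      (\<Prod>i\<in>inner_nodes n \<omega>. exp (- \<beta> * interaction (parent_offspring x \<omega> i) (offspring \<omega> i)))"
    using \<omega> by (simp add: energy_def sum_distrib_left exp_sum inner_nodes_def flip: sum_negf)
  also have "\<dots> = (\<Prod>i\<in>inner_nodes n \<omega>.
      coupling (exp \<beta>) (parent_offspring x \<omega> i) (offspring \<omega> i))"
    by (intro prod.cong) (auto simp: interaction_def coupling_def)
  finally have "gibbs_weight p \<beta> x n \<omega> = (\<Prod>i\<in>inner_nodes n \<omega>. ?N i)"
    unfolding gibbs_weight_def free_weight_def
    by (auto simp: prod.distrib[symmetric] node_weight_def inner_nodes_def intro!: prod.cong)
  moreover have "s ^ num_external n \<omega> = (\<Prod>i\<in>{i \<in> \<omega>. length i = Suc n}. ?N i)"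
    using num_external_eq_card[OF \<omega>(1)] by (simp add: node_weight_def)
  moreover have "\<omega> = inner_nodes n \<omega> \<union> {i \<in> \<omega>. length i = Suc n}"
    using len by (force simp: inner_nodes_def)
  then have "tree_weight p (exp \<beta>) s (Suc n) x \<omega> =
      (\<Prod>i\<in>inner_nodes n \<omega> \<union> {i \<in> \<omega>. length i = Suc n}. ?N i)"
    unfolding tree_weight_def by simp
  then have "tree_weight p (exp \<beta>) s (Suc n) x \<omega> =
      (\<Prod>i\<in>inner_nodes n \<omega>. ?N i) * (\<Prod>i\<in>{i \<in> \<omega>. length i = Suc n}. ?N i)"
    using \<omega> by (subst (asm) prod.union_disjoint) (auto simp: inner_nodes_def)
  ultimately show ?thesis by simp
qed

text \<open>At \<open>s = 1\<close> the generating function is the partition function. At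
  \<open>s = 0\<close> the extra factor is 1 on extinct trees, since \<open>0 ^ 0 = 1\<close>, and 0
  on all others.\<close>

lemma gibbs_prob_extinct:
  assumes "\<And>v :: real. summable (\<lambda>k. pmf p (k + 2) * v ^ (k + 2))"
  shows "gibbs_prob p \<beta> x n (\<lambda>\<omega>. num_external n \<omega> = 0) =
    weight_gf p (exp \<beta>) 0 (Suc n) x / weight_gf p (exp \<beta>) 1 (Suc n) x"
proof -
  have hs: "((\<lambda>\<omega>. gibbs_weight p \<beta> x n \<omega> * s ^ num_external n \<omega>)
      has_sum weight_gf p (exp \<beta>) s (Suc n) x) (trees n)" if "0 \<le> s" for s
    using tree_weight_has_sum[OF assms, of "exp \<beta>" s "Suc n" x] that
    by (subst has_sum_cong[OF gibbs_weight_eq_tree_weight]) (auto simp: trees_eq)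
  let ?Z = "partition_function p \<beta> x n"
  have Z: "?Z = weight_gf p (exp \<beta>) 1 (Suc n) x"
    unfolding partition_function_def using hs[of 1] by (intro infsumI) simp
  have "((\<lambda>\<omega>. inverse ?Z * (gibbs_weight p \<beta> x n \<omega> * 0 ^ num_external n \<omega>))
      has_sum inverse ?Z * weight_gf p (exp \<beta>) 0 (Suc n) x) (trees n)"
    by (intro has_sum_cmult_right hs) simp
  then have "(gibbs_measure p \<beta> x n has_sum inverse ?Z * weight_gf p (exp \<beta>) 0 (Suc n) x)
      {\<omega> \<in> trees n. num_external n \<omega> = 0}"
    by (rule iffD1[OF has_sum_cong_neutral, rotated -1]) (auto simp: gibbs_measure_def)
  then have "gibbs_prob p \<beta> x n (\<lambda>\<omega>. num_external n \<omega> = 0) =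
      inverse ?Z * weight_gf p (exp \<beta>) 0 (Suc n) x"
    unfolding gibbs_prob_def by (rule infsumI)
  then show ?thesis by (simp add: Z field_simps)
qed

subsection \<open>The fixed points and the critical value\<close>

definition R_deriv :: "nat pmf \<Rightarrow> real \<Rightarrow> real" where
  "R_deriv p v = (\<Sum>k. real (k + 2) * pmf p (k + 2) * v ^ (k + 1))"

locale offspring_law =
  fixes p :: "nat pmf"
  assumes p0_pos: "pmf p 0 > 0"
    and p01: "pmf p 0 + pmf p 1 < 1"
    and R_summable: "\<And>v :: real. summable (\<lambda>k. pmf p (k + 2) * v ^ (k + 2))"
    and mean_summable: "summable (\<lambda>k. real k * pmf p k)"
    and mean_le_1: "(\<Sum>k. real k * pmf p k) \<le> 1"
begin

section \<open>Convexity and growth of the power series \<open>R\<close>\<close>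

lemma p1_less_1: "pmf p 1 < 1"
  using p01 p0_pos by simp

lemma R_sums: "(\<lambda>k. pmf p (k + 2) * v ^ (k + 2)) sums R p v"
  unfolding R_def by (rule summable_sums[OF R_summable])

lemma
  shows R_deriv_sums: "(\<lambda>k. real (k + 2) * pmf p (k + 2) * v ^ (k + 1)) sums R_deriv p v"
    and has_field_derivative_R: "(R p has_real_derivative R_deriv p v) (at v)"
    and isCont_R_deriv: "isCont (R_deriv p) v"
proof -
  \<comment> \<open>Padding with two zero coefficients makes \<open>R\<close> a power series indexed
    from 0, to which termwise differentiation via \<open>diffs\<close> applies.\<close>
  define c where "c n = (if n < 2 then 0 else pmf p n)" for n
  have sm: "summable (\<lambda>n. c n * y ^ n)" for y
    by (subst summable_iff_shift[of _ 2, symmetric]) (use R_summable[of y] in \<open>simp add: c_def\<close>)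
  have R_eq: "R p y = (\<Sum>n. c n * y ^ n)" for y
    unfolding R_def
    by (subst suminf_split_initial_segment[OF sm, of _ 2]) (simp add: c_def numeral_2_eq_2)
  have dsm: "summable (\<lambda>n. diffs c n * y ^ n)" for y
    by (rule termdiff_converges_all[OF sm])
  have shift: "diffs c (n + 1) * y ^ (n + 1) = real (n + 2) * pmf p (n + 2) * y ^ (n + 1)" for n y
    by (simp add: diffs_def c_def)
  have sm': "summable (\<lambda>k. real (k + 2) * pmf p (k + 2) * y ^ (k + 1))" for y
    using dsm[of y] by (subst (asm) summable_iff_shift[of _ 1, symmetric]) (simp only: shift)
  then show "(\<lambda>k. real (k + 2) * pmf p (k + 2) * v ^ (k + 1)) sums R_deriv p v"
    unfolding R_deriv_def by (rule summable_sums)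
  have R_deriv_eq: "(\<Sum>n. diffs c n * y ^ n) = R_deriv p y" for y
    unfolding R_deriv_def
    by (subst suminf_split_initial_segment[OF dsm, of _ 1])
      (simp only: shift, simp add: diffs_def c_def)
  have "((\<lambda>y. \<Sum>n. c n * y ^ n) has_real_derivative (\<Sum>n. diffs c n * v ^ n)) (at v)"
    by (rule termdiffs_strong_converges_everywhere[OF sm])
  moreover have "R p = (\<lambda>y. \<Sum>n. c n * y ^ n)" using R_eq by auto
  ultimately show "(R p has_real_derivative R_deriv p v) (at v)" by (simp add: R_deriv_eq)
  have "isCont (\<lambda>y. \<Sum>n. diffs c n * y ^ n) v"
    by (rule DERIV_isCont[OF termdiffs_strong_converges_everywhere[OF dsm]])
  then show "isCont (R_deriv p) v" by (simp add: R_deriv_eq)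
qed

lemma deriv_R: "deriv (R p) v = R_deriv p v"
  by (rule DERIV_imp_deriv[OF has_field_derivative_R])

lemma isCont_R: "isCont (R p) v"
  by (rule DERIV_isCont[OF has_field_derivative_R])

lemma R_0: "R p 0 = 0"
  by (simp add: R_def)

lemma R_mono: "0 \<le> v \<Longrightarrow> v \<le> w \<Longrightarrow> R p v \<le> R p w"
  by (rule sums_le[OF _ R_sums R_sums]) (intro mult_left_mono power_mono pmf_nonneg)

lemmas R_nonneg' = R_nonneg[OF R_summable]

lemma pmf_sums: "pmf p sums 1"
proof -
  have "(pmf p has_sum 1) UNIV"
    using infsetsum_pmf_eq_1[of p UNIV] pmf_abs_summable[of p UNIV]
      abs_summable_summable[OF iffD2[OF abs_summable_equivalent pmf_abs_summable[of p UNIV]]]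
    by (simp add: infsetsum_infsum has_sum_iff)
  then show ?thesis by (rule has_sum_imp_sums)
qed

lemma R_1: "R p 1 = 1 - pmf p 0 - pmf p 1"
proof -
  have "(\<lambda>k. pmf p (k + 2)) sums (1 - (\<Sum>k<2. pmf p k))"
    using pmf_sums by (subst sums_iff_shift)  simp
  then show ?thesis
    using R_sums[of 1] sums_unique2 by (fastforce simp: numeral_2_eq_2)
qed

text \<open>The mean of the law is \<open>pmf p 1 + R_deriv p 1\<close>, so this is the form in
  which the assumption on the free process enters.\<close>

lemma R_deriv_1_le: "R_deriv p 1 \<le> 1 - pmf p 1"
proof -
  have "(\<lambda>k. real (k + 2) * pmf p (k + 2)) sums ((\<Sum>k. real k * pmf p k) - (\<Sum>k<2. real k * pmf p k))"
    using summable_sums[OF mean_summable] by (subst sums_iff_shift) simp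
  then show ?thesis
    using R_deriv_sums[of 1] mean_le_1 sums_unique2 by (fastforce simp: numeral_2_eq_2)
qed

text \<open>Otherwise \<open>R p 1\<close> would vanish, leaving no mass beyond 0 and 1. The strict
  convexity and the quadratic growth of \<open>R\<close> rest on this coefficient.\<close>

lemma ex_branching: "\<exists>k. pmf p (k + 2) > 0"
proof (rule ccontr)
  assume "\<not> ?thesis"
  then have "pmf p (k + 2) = 0" for k
    by (metis order_le_less pmf_nonneg)
  then have "R p 1 = 0" by (simp add: R_def)
  then show False using R_1 p01 by simp
qed

lemma R_deriv_strict_mono:
  assumes "0 \<le> v" "v < w"
  shows "R_deriv p v < R_deriv p w"
proof -
  let ?f = "\<lambda>k. real (k + 2) * pmf p (k + 2) * w ^ (k + 1) - real (k + 2) * pmf p (k + 2) * v ^ (k + 1)"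
  have f: "?f sums (R_deriv p w - R_deriv p v)"
    by (intro sums_diff R_deriv_sums)
  obtain j where j: "pmf p (j + 2) > 0" using ex_branching by blast
  have "0 < suminf ?f"
  proof (rule suminf_pos2)
    show "summable ?f" using f by (rule sums_summable)
    show "0 \<le> ?f k" for k
      using power_mono[of v w "k + 1"] assms by (simp del: power_Suc add: mult_left_mono)
    show "0 < ?f j"
      using power_strict_mono[of v w "j + 1"] assms j by (simp del: power_Suc)
  qed
  then show ?thesis using sums_unique[OF f] by simp
qed

lemma R_deriv_pos: "0 < v \<Longrightarrow> 0 < R_deriv p v"
  using R_deriv_strict_mono[of 0 v] by (simp add: R_deriv_def)

text \<open>Strict convexity: the mean value theorem on either side of \<open>w\<close>, with a
  strictly increasing derivative.\<close>

lemma R_tangent_strict: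
  assumes "0 \<le> v" "0 \<le> w" "v \<noteq> w"
  shows "R p w + R_deriv p w * (v - w) < R p v"
proof (cases "v < w")
  case True
  obtain z where z: "v < z" "z < w" "R p w - R p v = (w - v) * R_deriv p z"
    using MVT2[OF True has_field_derivative_R] by blast
  have "(w - v) * R_deriv p z < (w - v) * R_deriv p w"
    using z assms True by (intro mult_strict_left_mono R_deriv_strict_mono) auto
  then show ?thesis using z by (simp add: algebra_simps)
next
  case False
  then have "w < v" using assms by simp
  then obtain z where z: "w < z" "z < v" "R p v - R p w = (v - w) * R_deriv p z"
    using MVT2[OF _ has_field_derivative_R] by blast
  have "(v - w) * R_deriv p w < (v - w) * R_deriv p z"
    using z assms by (intro mult_strict_left_mono R_deriv_strict_mono) auto
  then show ?thesis using z by (simp add: algebra_simps)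
qed

lemma R_tangent:
  assumes "0 \<le> v" "0 \<le> w"
  shows "R p w + R_deriv p w * (v - w) \<le> R p v"
  using R_tangent_strict[OF assms] by (cases "v = w") auto

lemma R_pos: "0 < v \<Longrightarrow> 0 < R p v"
  using R_tangent_strict[of v 0] R_0 by (simp add: R_deriv_def)

text \<open>Termwise, because every exponent in \<open>R\<close> is at least 2.\<close>

lemma two_R_le: "0 \<le> v \<Longrightarrow> 2 * R p v \<le> v * R_deriv p v"
proof (rule sums_le[OF _ sums_mult[OF R_sums] sums_mult[OF R_deriv_sums]])
  fix k assume "0 \<le> v"
  then have "2 * (pmf p (k + 2) * v ^ (k + 2)) \<le> real (k + 2) * (pmf p (k + 2) * v ^ (k + 2))"
    by (intro mult_right_mono) auto
  then show "2 * (pmf p (k + 2) * v ^ (k + 2)) \<le> v * (real (k + 2) * pmf p (k + 2) * v ^ (k + 1))"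
    by (simp add: algebra_simps)
qed

lemma R_superquadratic: "\<exists>c>0. \<forall>v\<ge>1. c * v\<^sup>2 \<le> R p v"
proof -
  obtain j where j: "pmf p (j + 2) > 0" using ex_branching by blast
  have "pmf p (j + 2) * v\<^sup>2 \<le> R p v" if "1 \<le> v" for v
  proof -
    have "pmf p (j + 2) * v\<^sup>2 \<le> pmf p (j + 2) * v ^ (j + 2)"
      using that by (intro mult_left_mono power_increasing) auto
    also have "\<dots> = (\<Sum>k\<in>{j}. pmf p (k + 2) * v ^ (k + 2))" by simp
    also have "\<dots> \<le> R p v"
      unfolding R_def using that by (intro sum_le_suminf R_summable) auto
    finally show ?thesis .
  qed
  with j show ?thesis by blast
qed

section \<open>The critical system\<close>

definition R_coeff :: "real \<Rightarrow> real" where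
  "R_coeff b = ((1 - pmf p 1) * b + pmf p 1) / (1 - pmf p 1)"

text \<open>With these two constants the first critical equation reads
  \<open>v = intercept + R_coeff b * R p v\<close>.\<close>

definition intercept :: real where
  "intercept = pmf p 0 / (1 - pmf p 1)"

lemma R_coeff_eq: "R_coeff b = b + pmf p 1 / (1 - pmf p 1)"
  using p1_less_1 by (simp add: R_coeff_def field_simps)

lemma critical_system_iff:
  "critical_system p b v \<longleftrightarrow> v = intercept + R_coeff b * R p v \<and> 1 = R_coeff b * R_deriv p v"
  by (simp add: critical_system_def intercept_def R_coeff_def deriv_R)

text \<open>The two equations say that the convex curve \<open>intercept + R_coeff b * R p w\<close>
  meets the diagonal at \<open>v\<close> with slope 1. The diagonal is thus its tangent there, and a
  convex curve lies above its tangents.\<close>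

lemma critical_system_tangent:
  assumes "critical_system p b v" "0 \<le> v" "0 \<le> w"
  shows "w \<le> intercept + R_coeff b * R p w"
proof -
  from assms have v: "v = intercept + R_coeff b * R p v" "1 = R_coeff b * R_deriv p v"
    by (simp_all add: critical_system_iff)
  \<comment> \<open>Convexity of the curve needs this sign; it comes from the second equation, since
    \<open>R_deriv p v\<close> is nonnegative.\<close>
  have "0 < R_coeff b"
  proof (rule ccontr)
    assume "\<not> ?thesis"
    moreover have "0 \<le> R_deriv p v"
      using R_deriv_pos[of v] assms by (cases "v = 0") (auto simp: R_deriv_def)
    ultimately have "R_coeff b * R_deriv p v \<le> 0" by (simp add: mult_nonpos_nonneg)
    then show False using v by simp
  qed
  then have "R_coeff b * (R p v + R_deriv p v * (w - v)) \<le> R_coeff b * R p w"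
    using R_tangent[of w v] assms by (intro mult_left_mono) auto
  moreover have "R_coeff b * (R p v + R_deriv p v * (w - v))
      = R_coeff b * R p v + (R_coeff b * R_deriv p v) * (w - v)"
    by (simp add: algebra_simps)
  ultimately show ?thesis using v by simp
qed

text \<open>The intermediate value theorem on \<open>{1..2}\<close> yields \<open>v\<close>: the
  sign at 1 comes from the bound on the mean, the sign at 2 from \<open>two_R_le\<close>. Then
  \<open>b\<close> is read off the second equation.\<close>

lemma critical_system_ex: "\<exists>b v. 1 \<le> v \<and> critical_system p b v"
proof -
  \<comment> \<open>what remains of the critical system after eliminating \<open>b\<close>\<close>
  let ?h = "\<lambda>v. (v - intercept) * R_deriv p v - R p v"
  have intercept_le: "intercept \<le> 1" using p01 p1_less_1 by (simp add: intercept_def)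
  have "1 - intercept = R p 1 / (1 - pmf p 1)"
    using p1_less_1 by (simp add: intercept_def R_1 field_simps)
  then have "?h 1 = R p 1 * (R_deriv p 1 / (1 - pmf p 1) - 1)"
    by (simp add: right_diff_distrib)
  also have "\<dots> \<le> 0"
    using R_deriv_1_le p1_less_1 R_nonneg'[of 1] by (intro mult_nonneg_nonpos) auto
  finally have "?h 1 \<le> 0" .
  moreover have "0 \<le> ?h 2"
  proof -
    have "R p 2 \<le> 1 * R_deriv p 2" using two_R_le[of 2] by simp
    also have "\<dots> \<le> (2 - intercept) * R_deriv p 2"
      using intercept_le R_deriv_pos[of 2] by (intro mult_right_mono) auto
    finally show ?thesis by simp
  qed
  moreover have "continuous_on {1..2} ?h"
    by (intro continuous_at_imp_continuous_on ballI continuous_intros isCont_R isCont_R_deriv)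
  ultimately obtain v where v: "1 \<le> v" "?h v = 0"
    using IVT'[of ?h 1 0 2] by auto
  define b where "b = 1 / R_deriv p v - pmf p 1 / (1 - pmf p 1)"
  have "R_coeff b = 1 / R_deriv p v" by (simp add: b_def R_coeff_eq)
  moreover have "0 < R_deriv p v" using v R_deriv_pos by simp
  moreover from this have "v = intercept + R p v / R_deriv p v"
    using v by (simp add: field_simps)
  ultimately have "critical_system p b v"
    by (simp add: critical_system_iff)
  then show ?thesis using v by blast
qed

text \<open>Testing the tangency bound of one solution at the contact point of the other compares
  the coefficients. By symmetry they agree, and strict monotonicity of \<open>R_deriv\<close>
  identifies the contact points.\<close>

lemma critical_system_unique:
  assumes 1: "1 \<le> v" "critical_system p b v" and 2: "1 \<le> v'" "critical_system p b' v'"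
  shows "b = b' \<and> v = v'"
proof -
  have le: "R_coeff b \<le> R_coeff b'"
    if "1 \<le> v" "critical_system p b v" "1 \<le> v'" "critical_system p b' v'" for b v b' v'
  proof -
    have "v \<le> intercept + R_coeff b' * R p v"
      using that by (intro critical_system_tangent[of b' v']) auto
    then have "R_coeff b * R p v \<le> R_coeff b' * R p v"
      using that by (simp add: critical_system_iff)
    then show ?thesis using R_pos[of v] that by simp
  qed
  have s: "R_coeff b = R_coeff b'"
    using le[OF 1 2] le[OF 2 1] by simp
  then have "b = b'" by (simp add: R_coeff_eq)
  moreover have "R_coeff b * R_deriv p v = R_coeff b * R_deriv p v'"
    using assms s by (simp add: critical_system_iff)
  then have "R_deriv p v = R_deriv p v'"
    using 1 by (auto simp: critical_system_iff)
  then have "v = v'"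
    using R_deriv_strict_mono[of v v'] R_deriv_strict_mono[of v' v] assms by linarith
  ultimately show ?thesis by simp
qed

text \<open>Existence and uniqueness together make the definite description in
  \<open>critical_point\<close> denote a solution.\<close>

lemma critical_system_b_crit: "\<exists>v\<ge>1. critical_system p (b_crit p) v"
proof -
  obtain b v where bv: "1 \<le> v" "critical_system p b v"
    using critical_system_ex by blast
  have "critical_point p = (b, v)"
    unfolding critical_point_def using bv by (intro the_equality) (auto dest: critical_system_unique)
  then show ?thesis using bv by (auto simp: b_crit_def)
qed

section \<open>Monotonicity and limits of the iterates\<close>

lemma weight_gf_step_mono:
  assumes "0 \<le> b" "\<And>x. 0 \<le> weight_gf p b s m x" "\<And>x. weight_gf p b s m x \<le> weight_gf p b t n x"
  shows "weight_gf p b s (Suc m) x \<le> weight_gf p b t (Suc n) x"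
  using assms by (auto intro!: add_mono mult_left_mono R_mono)

lemmas weight_gf_nonneg' = weight_gf_nonneg[OF R_summable]

lemma weight_gf_0_le_Suc: "0 \<le> b \<Longrightarrow> weight_gf p b 0 m x \<le> weight_gf p b 0 (Suc m) x"
proof (induction m arbitrary: x)
  case 0
  then show ?case using weight_gf_nonneg'[of b 0 "Suc 0" x] by simp
next
  case (Suc m)
  then show ?case by (intro weight_gf_step_mono weight_gf_nonneg') auto
qed

lemma incseq_weight_gf_0: "0 \<le> b \<Longrightarrow> incseq (\<lambda>m. weight_gf p b 0 m x)"
  by (intro incseq_SucI weight_gf_0_le_Suc)

text \<open>The first iterate from 0 is \<open>pmf p 0\<close>, at most 1; monotonicity of the
  iteration preserves this lead of one step.\<close>

lemma weight_gf_0_Suc_le_weight_gf_1: "0 \<le> b \<Longrightarrow> weight_gf p b 0 (Suc m) x \<le> weight_gf p b 1 m x"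
proof (induction m arbitrary: x)
  case 0
  then show ?case by (simp add: R_0 pmf_le_1)
next
  case (Suc m)
  then show ?case by (intro weight_gf_step_mono weight_gf_nonneg') auto
qed

lemma weight_gf_0_le_weight_gf_1: "0 \<le> b \<Longrightarrow> weight_gf p b 0 m x \<le> weight_gf p b 1 m x"
  using weight_gf_0_le_Suc weight_gf_0_Suc_le_weight_gf_1 order_trans by blast

lemma weight_gf_le_weight_gf_2:
  assumes "1 \<le> b" "0 \<le> s"
  shows "weight_gf p b s m x \<le> weight_gf p b s m 2"
proof (cases m)
  case (Suc k)
  have "1 * R p (weight_gf p b s k 2) \<le> b * R p (weight_gf p b s k 2)"
    using assms by (intro mult_right_mono R_nonneg' weight_gf_nonneg') auto
  then show ?thesis using Suc by simp
qed simp

text \<open>The pair \<open>(u, w)\<close> is a supersolution: one step of the monotone iteration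
  does not raise it, so iterates that start below it stay below.\<close>

lemma weight_gf_bounded:
  assumes "0 \<le> b" "0 \<le> s" "s \<le> u" "s \<le> w"
    and u: "pmf p 0 + pmf p 1 * u + R p w \<le> u" and w: "pmf p 0 + pmf p 1 * u + b * R p w \<le> w"
  shows "weight_gf p b s m 1 \<le> u \<and> weight_gf p b s m 2 \<le> w"
proof (induction m)
  case (Suc m)
  have "pmf p 1 * weight_gf p b s m 1 \<le> pmf p 1 * u" "R p (weight_gf p b s m 2) \<le> R p w"
    using Suc assms by (auto intro!: mult_left_mono R_mono weight_gf_nonneg')
  moreover from this(2) have "b * R p (weight_gf p b s m 2) \<le> b * R p w"
    using assms by (intro mult_left_mono)
  ultimately have "weight_gf p b s (Suc m) 1 \<le> u" "weight_gf p b s (Suc m) 2 \<le> w"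
    using u w by auto
  then show ?case by blast
qed (use assms in auto)

text \<open>Bounding the second component suffices, as it dominates the first. Monotone limits solve
  the fixed point equation by continuity of \<open>R\<close>, and the first iterate keeps
  \<open>w\<close> away from 0.\<close>

lemma weight_gf_0_converges:
  assumes "1 \<le> b" and bdd: "\<And>m. weight_gf p b 0 m 2 \<le> C"
  obtains u w where "(\<lambda>m. weight_gf p b 0 m 1) \<longlonglongrightarrow> u" "(\<lambda>m. weight_gf p b 0 m 2) \<longlonglongrightarrow> w"
    "u = pmf p 0 + pmf p 1 * u + R p w" "w = pmf p 0 + pmf p 1 * u + b * R p w" "pmf p 0 \<le> w"
proof -
  have inc: "incseq (\<lambda>m. weight_gf p b 0 m x)" for x
    using assms by (intro incseq_weight_gf_0) simp
  obtain w where w: "(\<lambda>m. weight_gf p b 0 m 2) \<longlonglongrightarrow> w"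
    by (rule incseq_convergent[OF inc allI[OF bdd]])
  have bdd1: "weight_gf p b 0 m 1 \<le> C" for m
    using assms by (intro order_trans[OF weight_gf_le_weight_gf_2 bdd]) auto
  obtain u where u: "(\<lambda>m. weight_gf p b 0 m 1) \<longlonglongrightarrow> u"
    by (rule incseq_convergent[OF inc allI[OF bdd1]])
  have lim: "(\<lambda>m. weight_gf p b 0 (Suc m) x) \<longlonglongrightarrow>
      pmf p 0 + pmf p 1 * u + (if x \<ge> 2 then b else 1) * R p w" for x
    unfolding weight_gf.simps by (intro tendsto_intros u isCont_tendsto_compose[OF isCont_R] w)
  have "u = pmf p 0 + pmf p 1 * u + R p w"
    using LIMSEQ_unique[OF LIMSEQ_Suc[OF u] lim] by simp
  moreover have w_eq: "w = pmf p 0 + pmf p 1 * u + b * R p w"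
    using LIMSEQ_unique[OF LIMSEQ_Suc[OF w] lim] by simp
  moreover have "pmf p 0 \<le> w"
    using incseq_le[OF inc w, of 1] by (simp add: R_0)
  ultimately show thesis using that u w by blast
qed

text \<open>The equation is linear in \<open>u\<close>. Solving it and substituting leaves a
  one-dimensional map in \<open>w\<close> with the constants of the critical system.\<close>

lemma fixed_point_reduce:
  assumes "u = pmf p 0 + pmf p 1 * u + R p w"
  shows "u = (pmf p 0 + R p w) / (1 - pmf p 1)"
    and "pmf p 0 + pmf p 1 * u + b * R p w = intercept + R_coeff b * R p w"
proof -
  have "u * (1 - pmf p 1) = pmf p 0 + R p w" using assms by (simp add: algebra_simps)
  then show u: "u = (pmf p 0 + R p w) / (1 - pmf p 1)" using p1_less_1 by (simp add: field_simps)
  have "(1 - pmf p 1) / (1 - pmf p 1) = 1"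
    using p1_less_1 by simp
  then have "1 / (1 - pmf p 1) = 1 + pmf p 1 / (1 - pmf p 1)"
    by (simp only: diff_divide_distrib)
  then have "R p w / (1 - pmf p 1) = R p w + pmf p 1 / (1 - pmf p 1) * R p w"
    by (metis distrib_right mult_1 times_divide_eq_left)
  moreover have "pmf p 0 + pmf p 1 * u = intercept + R p w / (1 - pmf p 1) - R p w"
    using assms u by (simp add: intercept_def add_divide_distrib)
  ultimately show "pmf p 0 + pmf p 1 * u + b * R p w = intercept + R_coeff b * R p w"
    by (simp add: R_coeff_eq distrib_right)
qed

text \<open>For \<open>b = 1\<close> the reduced map fixes 1 with slope at most 1, so by strict
  convexity it lies strictly above the diagonal to the left of 1. A larger \<open>b\<close> only
  raises it.\<close>

lemma fixed_point_ge_1: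
  assumes "1 \<le> b" "0 \<le> w" "w = intercept + R_coeff b * R p w"
  shows "1 \<le> w"
proof (rule ccontr)
  assume "\<not> 1 \<le> w"
  have pos: "0 < 1 / (1 - pmf p 1)" using p1_less_1 by simp
  have "1 = intercept + R p 1 / (1 - pmf p 1)"
    using p1_less_1 by (simp add: intercept_def R_1 flip: add_divide_distrib)
  \<comment> \<open>The slope at 1 is at most 1, and the factor \<open>w - 1\<close> is
    negative.\<close>
  moreover have "w - 1 \<le> R_deriv p 1 / (1 - pmf p 1) * (w - 1)"
    using R_deriv_1_le p1_less_1 \<open>\<not> 1 \<le> w\<close>
      mult_right_mono_neg[of "R_deriv p 1 / (1 - pmf p 1)" 1 "w - 1"] by simp
  ultimately have "w \<le> intercept + R p 1 / (1 - pmf p 1) + R_deriv p 1 / (1 - pmf p 1) * (w - 1)"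
    by linarith
  also have "\<dots> = intercept + 1 / (1 - pmf p 1) * (R p 1 + R_deriv p 1 * (w - 1))"
    by (simp add: add_divide_distrib)
  also have "\<dots> < intercept + 1 / (1 - pmf p 1) * R p w"
    using R_tangent_strict[of w 1] assms \<open>\<not> 1 \<le> w\<close> pos by (intro add_strict_left_mono mult_strict_left_mono) auto
  also have "\<dots> \<le> intercept + R_coeff b * R p w"
  proof -
    have "1 / (1 - pmf p 1) = R_coeff 1" using p1_less_1 by (simp add: R_coeff_def)
    also have "\<dots> \<le> R_coeff b" using assms by (simp add: R_coeff_eq)
    finally show ?thesis
      using assms R_nonneg'[of w] by (intro add_left_mono mult_right_mono)
  qed
  finally show False using assms by simp
qed

section \<open>Limits of the extinction ratio\<close>

lemma weight_gf_ratio_tendsto_1: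
  assumes "1 \<le> b" "b \<le> b_crit p" "1 \<le> x"
  shows "(\<lambda>m. weight_gf p b 0 m x / weight_gf p b 1 m x) \<longlonglongrightarrow> 1"
proof -
  obtain v where v: "1 \<le> v" "critical_system p (b_crit p) v"
    using critical_system_b_crit by blast
  \<comment> \<open>The first component belonging to \<open>v\<close>: the pair
    \<open>(uc, v)\<close> is fixed for \<open>b_crit p\<close>, hence a supersolution for smaller
    \<open>b\<close>.\<close>
  define uc where "uc = (pmf p 0 + R p v) / (1 - pmf p 1)"
  have uc: "uc = pmf p 0 + pmf p 1 * uc + R p v"
    using p1_less_1 by (simp add: uc_def field_simps)
  have "pmf p 0 + pmf p 1 * uc + b * R p v \<le> pmf p 0 + pmf p 1 * uc + b_crit p * R p v"
    using assms v R_nonneg' by (simp add: mult_right_mono)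
  also have "\<dots> = v"
    using fixed_point_reduce(2)[OF uc] v by (simp add: critical_system_iff)
  finally have "pmf p 0 + pmf p 1 * uc + b * R p v \<le> v" .
  moreover have "0 \<le> uc" unfolding uc_def using R_nonneg' v p1_less_1 by simp
  ultimately have "weight_gf p b 0 m 2 \<le> v" for m
    using weight_gf_bounded[of b 0 uc v m] uc v assms by simp
  then obtain u w where
    lim: "(\<lambda>m. weight_gf p b 0 m 1) \<longlonglongrightarrow> u" "(\<lambda>m. weight_gf p b 0 m 2) \<longlonglongrightarrow> w"
    and fp: "u = pmf p 0 + pmf p 1 * u + R p w" "w = pmf p 0 + pmf p 1 * u + b * R p w"
    and "pmf p 0 \<le> w"
    using weight_gf_0_converges[OF \<open>1 \<le> b\<close>] by metis
  have w1: "1 \<le> w"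
    using fixed_point_ge_1[OF \<open>1 \<le> b\<close>, of w] fixed_point_reduce(2)[OF fp(1)] fp(2) \<open>pmf p 0 \<le> w\<close> p0_pos
    by simp
  have "R p 1 \<le> R p w" using w1 by (intro R_mono) auto
  then have "1 \<le> u"
    unfolding fixed_point_reduce(1)[OF fp(1)] using p1_less_1 R_1 by (simp add: field_simps)
  then have bound: "weight_gf p b 1 m 1 \<le> u" "weight_gf p b 1 m 2 \<le> w" for m
    using weight_gf_bounded[of b 1 u w m] fp w1 assms by simp_all
  define l where "l = (if x \<ge> 2 then w else u)"
  have "weight_gf p b s m x = weight_gf p b s m (if x \<ge> 2 then 2 else 1)" for s m
    using weight_gf_eq[of x p b s m] assms by (cases "x \<ge> 2") (auto simp: not_le numeral_2_eq_2 less_Suc_eq)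
  then have lim0: "(\<lambda>m. weight_gf p b 0 m x) \<longlonglongrightarrow> l" and le: "weight_gf p b 1 m x \<le> l" for m
    using lim bound by (auto simp: l_def)
  have "weight_gf p b 0 m x \<le> weight_gf p b 1 m x" for m
    using assms by (intro weight_gf_0_le_weight_gf_1) simp
  then have "(\<lambda>m. weight_gf p b 1 m x) \<longlonglongrightarrow> l"
    by (intro tendsto_sandwich[OF always_eventually always_eventually lim0 tendsto_const] allI le)
  moreover have "l \<noteq> 0" using w1 \<open>1 \<le> u\<close> by (auto simp: l_def)
  ultimately show ?thesis using tendsto_divide[OF lim0, of "\<lambda>m. weight_gf p b 1 m x" l] by simp
qed

lemma weight_gf_0_at_top:
  assumes "1 \<le> b" "b_crit p < b"
  shows "filterlim (\<lambda>m. weight_gf p b 0 m 2) at_top sequentially"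
proof (rule ccontr)
  assume not: "\<not> ?thesis"
  have inc: "incseq (\<lambda>m. weight_gf p b 0 m 2)"
    using assms by (intro incseq_weight_gf_0) simp
  have "\<exists>C. \<forall>m. weight_gf p b 0 m 2 \<le> C"
  proof (rule ccontr)
    assume "\<not> ?thesis"
    then have "\<exists>m. C < weight_gf p b 0 m 2" for C by (meson not_le)
    then have "filterlim (\<lambda>m. weight_gf p b 0 m 2) at_top sequentially"
      unfolding filterlim_at_top eventually_sequentially
      using incseqD[OF inc] by (meson less_imp_le order_trans)
    then show False using not by blast
  qed
  then obtain u w where fp: "u = pmf p 0 + pmf p 1 * u + R p w"
      "w = pmf p 0 + pmf p 1 * u + b * R p w" and w: "pmf p 0 \<le> w"
    using weight_gf_0_converges[OF \<open>1 \<le> b\<close>] by metis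
  obtain v where v: "1 \<le> v" "critical_system p (b_crit p) v"
    using critical_system_b_crit by blast
  \<comment> \<open>Tangency keeps the reduced map for \<open>b_crit p\<close> on or above the
    diagonal. As \<open>R p w\<close> is positive, the larger coefficient lifts it strictly above,
    so \<open>w\<close> cannot be fixed.\<close>
  have "w \<le> intercept + R_coeff (b_crit p) * R p w"
    using v w p0_pos by (intro critical_system_tangent[of _ v]) auto
  also have "\<dots> < intercept + R_coeff b * R p w"
    using assms R_pos[of w] w p0_pos by (simp add: R_coeff_eq)
  finally show False using fixed_point_reduce(2)[OF fp(1)] fp(2) by simp
qed

lemma weight_gf_ratio_tendsto_0:
  assumes "1 \<le> b" "b_crit p < b"
  shows "(\<lambda>m. weight_gf p b 0 m x / weight_gf p b 1 m x) \<longlonglongrightarrow> 0"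
proof -
  let ?w = "\<lambda>m. weight_gf p b 0 m 2"
  obtain c where c: "0 < c" "\<And>v. 1 \<le> v \<Longrightarrow> c * v\<^sup>2 \<le> R p v"
    using R_superquadratic by blast
  note top = weight_gf_0_at_top[OF assms]
  \<comment> \<open>The numerator is at most \<open>?w m\<close>, while the denominator, one step
    ahead, is at least \<open>c * (?w m)\<^sup>2\<close>.\<close>
  have "weight_gf p b 0 m x / weight_gf p b 1 m x \<le> inverse c * inverse (?w m)" if "1 \<le> ?w m" for m
  proof -
    have "c * (?w m)\<^sup>2 \<le> 1 * R p (?w m)" using c that by simp
    also have "\<dots> \<le> (if x \<ge> 2 then b else 1) * R p (?w m)"
      using assms that by (intro mult_right_mono R_nonneg') auto
    also have "\<dots> \<le> weight_gf p b 0 (Suc m) x"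
      using assms by (simp add: weight_gf_nonneg')
    also have "\<dots> \<le> weight_gf p b 1 m x"
      using assms by (intro weight_gf_0_Suc_le_weight_gf_1) simp
    finally have "c * (?w m)\<^sup>2 \<le> weight_gf p b 1 m x" .
    then have "weight_gf p b 0 m x / weight_gf p b 1 m x \<le> ?w m / (c * (?w m)\<^sup>2)"
      using assms that c by (intro frac_le weight_gf_le_weight_gf_2) auto
    then show ?thesis using that c by (simp add: field_simps power2_eq_square)
  qed
  moreover have "eventually (\<lambda>m. 1 \<le> ?w m) sequentially"
    using top by (simp add: filterlim_at_top)
  ultimately have upper:
      "eventually (\<lambda>m. weight_gf p b 0 m x / weight_gf p b 1 m x \<le> inverse c * inverse (?w m)) sequentially"
    by (auto elim: eventually_mono)
  have lim: "(\<lambda>m. inverse c * inverse (?w m)) \<longlonglongrightarrow> 0"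
    using tendsto_mult_right_zero[OF tendsto_inverse_0_at_top[OF top], of "inverse c"] .
  have "0 \<le> weight_gf p b 0 m x / weight_gf p b 1 m x" for m
    using assms by (intro divide_nonneg_nonneg weight_gf_nonneg') auto
  then show ?thesis
    by (intro tendsto_sandwich[OF always_eventually upper tendsto_const lim] allI)
qed

end

theorem proposition1:
  fixes p :: "nat pmf" and \<beta> :: real and x :: nat
  assumes "pmf p 0 > 0"
    and "pmf p 0 + pmf p 1 < 1"
    and "\<And>v :: real. summable (\<lambda>k. pmf p (k + 2) * v ^ (k + 2))"
    and "subcritical p \<or> critical p"
    and "\<beta> \<ge> 0"
    and "x \<ge> 1"
  shows "\<exists>\<rho>. (\<lambda>n. gibbs_prob p \<beta> x n (\<lambda>\<omega>. num_external n \<omega> = 0)) \<longlonglongrightarrow> \<rho> \<and>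
    (exp \<beta> \<le> b_crit p \<longrightarrow> \<rho> = 1) \<and>
    (exp \<beta> > b_crit p \<and> b_crit p > 1 \<longrightarrow> \<rho> = 0)"
proof -
  interpret offspring_law p
    using assms by unfold_locales (auto simp: subcritical_def critical_def sums_iff)
  have b: "1 \<le> exp \<beta>" using assms by simp
  \<comment> \<open>The index is \<open>Suc n\<close> because the external nodes of trees in
    \<open>trees n\<close> lie at depth \<open>n + 1\<close>; the shift does not affect the
    limit.\<close>
  have "(\<lambda>n. weight_gf p (exp \<beta>) 0 (Suc n) x / weight_gf p (exp \<beta>) 1 (Suc n) x) \<longlonglongrightarrow>
      (if exp \<beta> \<le> b_crit p then 1 else 0)"
    using weight_gf_ratio_tendsto_1[OF b _ \<open>x \<ge> 1\<close>] weight_gf_ratio_tendsto_0[OF b, of x]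
    by (intro LIMSEQ_Suc[where f = "\<lambda>m. weight_gf p (exp \<beta>) 0 m x / weight_gf p (exp \<beta>) 1 m x"]) auto
  then show ?thesis
    unfolding gibbs_prob_extinct[OF assms(3)] by force
qed

end
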